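(* Let $\rho<0$ and consider the unicycle in closed loop with the feedback below, i.e. $$\begin{bmatrix}\dot x_c\\ \dot y_c\end{bmatrix}=\rho\begin{bmatrix}\cos\theta\\ \sin\theta\end{bmatrix}\bigl(\cos(\theta)\,x_c+\sin(\theta)\,y_c\bigr),\qquad \dot\theta=\rho\,\theta ,$$ where, by a rescaling of time, $\rho$ is normalized to $\rho=-1$. Put $X=(x_c,y_c)'$, define $Z=(z_1,z_2)'$ by $X(t)=R(\theta(t))Z(t)$, and write the solutions as $$\theta(t)=\theta_0e^{-t},\qquad z_1=\theta\,[C_1J_0(\theta)+C_2Y_0(\theta)],\qquad z_2=\frac{\dot z_1+z_1}{\dot\theta},$$ with $C_1,C_2$ constants depending on the initial conditions. Then $$\lim_{t\to\infty}z_1(t)=0,\qquad \lim_{t\to\infty}z_2(t)=\frac{C_2}{\pi},\qquad \lim_{t\to\infty}X(t)=\begin{bmatrix}0\\ C_2/\pi\end{bmatrix},$$ so that the set of attractors is the whole $y_c$ axis. Imposing $C_2=0$ does not allow arbitrary initial conditions $X(0)\in\mathbb{R}^2$. Consequently the coordinate $x_c$ is asymptotically stable, while the coordinate $y_c$ is not.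
   Context: The unicycle kinematic model is $\dot x_c=u_1\cos\theta$, $\dot y_c=u_1\sin\theta$, $\dot\theta=u_2$, where $(x_c,y_c)\in\mathbb{R}^2$ is the position of the wheel baseline center and $\theta\in\mathbb{R}$ the attitude. The feedback is $u_1=\rho\,(x_c\cos\theta+y_c\sin\theta)$, $u_2=\rho\,\theta$. $R(\theta)=\begin{bmatrix}\cos\theta&-\sin\theta\\ \sin\theta&\cos\theta\end{bmatrix}$ is the rotation matrix. $J_0$ and $Y_0$ are the Bessel functions of order $0$ of the first and second kind.
   Formalization: With the standard Y_0 ~ (2/π) ln x, the limits of z_2 and y_c are 2C_2/π, not C_2/π as printed; the formal theorem proves 2C_2/π. The Bessel formulas are taken for θ_0 ≠ 0, where they are defined, and Y_0(θ) is read as Y_0(|θ|) for θ < 0. *)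

theory Defs
  imports "HOL-Analysis.Analysis"
begin

definition bessel_J0 :: "real \<Rightarrow> real" where
  "bessel_J0 x = (\<Sum>k. (-1) ^ k * (x\<^sup>2 / 4) ^ k / (fact k)\<^sup>2)"

(* The standard (Weber) normalisation, DLMF 10.8.2.  The logarithm is taken of \<bar>x\<bar>, so that for
   x < 0 the value is Y_0(-x), i.e. the real part of the principal branch; this is again a
   solution of Bessel's equation of order 0.  The term k = 0 of the series vanishes as harm 0 = 0. *)
definition bessel_Y0 :: "real \<Rightarrow> real" where
  "bessel_Y0 x =
     (2 / pi) * (ln (\<bar>x\<bar> / 2) + euler_mascheroni) * bessel_J0 x
   + (2 / pi) * (\<Sum>k. (-1) ^ (k + 1) * harm k * (x\<^sup>2 / 4) ^ k / (fact k)\<^sup>2)"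

definition rotation_matrix :: "real \<Rightarrow> real^2^2" where
  "rotation_matrix \<theta> = vector [vector [cos \<theta>, - sin \<theta>], vector [sin \<theta>, cos \<theta>]]"

definition unicycle ::
  "(real \<Rightarrow> real) \<Rightarrow> (real \<Rightarrow> real) \<Rightarrow> (real \<Rightarrow> real^2) \<Rightarrow> (real \<Rightarrow> real) \<Rightarrow> bool" where
  "unicycle u\<^sub>1 u\<^sub>2 X \<theta> \<longleftrightarrow>
     (\<forall>t\<ge>0.
        (X has_vector_derivative u\<^sub>1 t *\<^sub>R vector [cos (\<theta> t), sin (\<theta> t)]) (at t within {0..}) \<and>
        (\<theta> has_real_derivative u\<^sub>2 t) (at t within {0..}))"

definition closed_loop :: "real \<Rightarrow> (real \<Rightarrow> real^2) \<Rightarrow> (real \<Rightarrow> real) \<Rightarrow> bool" where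
  "closed_loop \<rho> X \<theta> \<longleftrightarrow>
     unicycle (\<lambda>t. \<rho> * (X t $ 1 * cos (\<theta> t) + X t $ 2 * sin (\<theta> t))) (\<lambda>t. \<rho> * \<theta> t) X \<theta>"

definition rotated_coords :: "(real \<Rightarrow> real^2) \<Rightarrow> (real \<Rightarrow> real) \<Rightarrow> (real \<Rightarrow> real^2) \<Rightarrow> bool" where
  "rotated_coords X \<theta> Z \<longleftrightarrow> (\<forall>t\<ge>0. X t = rotation_matrix (\<theta> t) *v Z t)"

(* Here d1 and d2 are the time derivatives of z_1 and of \<theta> at t. *)
definition bessel_form ::
  "real \<Rightarrow> real \<Rightarrow> real \<Rightarrow> (real \<Rightarrow> real) \<Rightarrow> (real \<Rightarrow> real^2) \<Rightarrow> bool" where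
  "bessel_form \<theta>\<^sub>0 C\<^sub>1 C\<^sub>2 \<theta> Z \<longleftrightarrow>
     (\<forall>t\<ge>0.
        \<theta> t = \<theta>\<^sub>0 * exp (- t) \<and>
        Z t $ 1 = \<theta> t * (C\<^sub>1 * bessel_J0 (\<theta> t) + C\<^sub>2 * bessel_Y0 (\<theta> t)) \<and>
        (\<exists>d1 d2. ((\<lambda>s. Z s $ 1) has_real_derivative d1) (at t within {0..}) \<and>
                 (\<theta> has_real_derivative d2) (at t within {0..}) \<and>
                 Z t $ 2 = (d1 + Z t $ 1) / d2))"

definition attractors_from :: "real \<Rightarrow> real \<Rightarrow> (real^2) set" where
  "attractors_from \<rho> \<theta>\<^sub>0 =
     {L. \<exists>X \<theta>. closed_loop \<rho> X \<theta> \<and> \<theta> 0 = \<theta>\<^sub>0 \<and> (X \<longlongrightarrow> L) at_top}"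

(* Partial (Lyapunov) stability of the origin of the state space with respect to the
   coordinate X $ i only: the initial state, \<theta> 0 included, is small, and only X $ i is observed. *)
definition coord_stable :: "real \<Rightarrow> 2 \<Rightarrow> bool" where
  "coord_stable \<rho> i \<longleftrightarrow>
     (\<forall>\<epsilon>>0. \<exists>\<delta>>0. \<forall>X \<theta>. closed_loop \<rho> X \<theta> \<and> norm (X 0, \<theta> 0) < \<delta> \<longrightarrow> (\<forall>t\<ge>0. \<bar>X t $ i\<bar> < \<epsilon>))"

definition coord_attractive :: "real \<Rightarrow> 2 \<Rightarrow> bool" where
  "coord_attractive \<rho> i \<longleftrightarrow>
     (\<exists>\<delta>>0. \<forall>X \<theta>. closed_loop \<rho> X \<theta> \<and> norm (X 0, \<theta> 0) < \<delta> \<longrightarrow> ((\<lambda>t. X t $ i) \<longlongrightarrow> 0) at_top)"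

definition coord_asymptotically_stable :: "real \<Rightarrow> 2 \<Rightarrow> bool" where
  "coord_asymptotically_stable \<rho> i \<longleftrightarrow> coord_stable \<rho> i \<and> coord_attractive \<rho> i"

end

(* In the attitude x = theta the rotated system reads z1' = z1/x + z2, z2' = -z1, so that z1 = x w(x)
   and z2 = x w'(x) where w solves Bessel's equation of order 0.  As x -> 0, x w -> 0, and x w' tends
   to 2 C2/pi because of the logarithm in Y_0.  The Wronskian x (J_0 Y_0' - J_0' Y_0) = 2/pi makes
   (C1, C2) <-> X(0) bijective for each theta_0 <> 0.  The norm of X never increases along solutions;
   this gives uniqueness and stability of x_c, while the equilibria (0, y) with theta = 0 prevent
   y_c from being attractive. *)
theory Submission
  imports Defs "HOL-Real_Asymp.Real_Asymp"
begin

text \<open>The equation in the attitude x is singular at x = 0, a point that a solution with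
  \<open>\<theta>\<^sub>0 \<noteq> 0\<close> approaches but never reaches in finite time. The
  asymptotics are thus a statement about the Bessel functions near 0, and zero attitude has to be
  treated apart by an elementary solution. Since z_2 = x w'(x) is itself the natural second unknown,
  Bessel's equation is used as a first-order pair for w and x w', so that no second derivative of w
  is needed. The analysis takes place on entire series in x^2/4, with the logarithm kept as an
  explicit factor. On the constant: in Weber's normalisation Y_0(x) behaves like (2/\<pi>) ln |x|
  near 0, so x Y_0'(x) tends to 2/\<pi>. With the standard Y_0 the limit is therefore
  \<open>2 * C\<^sub>2 / pi\<close> where the informal statement has C_2/\<pi>; the attractor set is
  the same for either factor.\<close>

section \<open>Power series under the Euler operator x d/dx\<close>

lemma
  fixes c :: "nat \<Rightarrow> real"
  assumes "\<And>y. summable (\<lambda>k. c k * y ^ k)"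
  shows sums_of_nat_mult_powser:
      "(\<lambda>k. (of_nat k * c k) * x ^ k) sums (x * (\<Sum>k. diffs c k * x ^ k))"
    and summable_of_nat_mult_powser: "summable (\<lambda>k. (of_nat k * c k) * x ^ k)"
proof -
  have "(\<lambda>k. x * (of_nat k * c k * x ^ (k - Suc 0))) sums (x * (\<Sum>k. diffs c k * x ^ k))"
    by (intro sums_mult diffs_equiv termdiff_converges_all assms)
  also have "(\<lambda>k. x * (of_nat k * c k * x ^ (k - Suc 0))) = (\<lambda>k. (of_nat k * c k) * x ^ k)"
  proof
    \<comment> \<open>At k = 0 the exponent \<open>k - Suc 0\<close> is truncated to 0, but there
      the factor \<open>of_nat k\<close> vanishes.\<close>
    show "x * (of_nat k * c k * x ^ (k - Suc 0)) = (of_nat k * c k) * x ^ k" for k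
      by (cases k) auto
  qed
  finally show "(\<lambda>k. (of_nat k * c k) * x ^ k) sums (x * (\<Sum>k. diffs c k * x ^ k))" .
  then show "summable (\<lambda>k. (of_nat k * c k) * x ^ k)"
    by (rule sums_summable)
qed

text \<open>The operator d/dx (x d/dx) squares the index and shifts it by one. Coefficient
  recurrences involving \<open>(of_nat (Suc k))\<^sup>2 * c (Suc k)\<close> therefore turn directly
  into differential equations.\<close>

lemma euler_operator_powser_deriv:
  fixes c :: "nat \<Rightarrow> real"
  assumes "\<And>y. summable (\<lambda>k. c k * y ^ k)"
  shows "((\<lambda>x. x * (\<Sum>k. diffs c k * x ^ k)) has_real_derivative
           (\<Sum>k. (of_nat (Suc k))\<^sup>2 * c (Suc k) * x ^ k)) (at x)"
proof -
  have "((\<lambda>x. \<Sum>k. (of_nat k * c k) * x ^ k) has_real_derivative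
          (\<Sum>k. diffs (\<lambda>k. of_nat k * c k) k * x ^ k)) (at x)"
    by (intro termdiffs_strong_converges_everywhere summable_of_nat_mult_powser assms)
  moreover have "(\<lambda>x. \<Sum>k. (of_nat k * c k) * x ^ k) = (\<lambda>x. x * (\<Sum>k. diffs c k * x ^ k))"
    using sums_of_nat_mult_powser[OF assms] by (auto simp: sums_iff)
  ultimately show ?thesis
    by (simp add: diffs_def power2_eq_square mult.assoc)
qed

lemma summable_powser_if_le_inverse_fact:
  fixes c :: "nat \<Rightarrow> real"
  assumes "\<And>k. \<bar>c k\<bar> \<le> inverse (fact k)"
  shows "summable (\<lambda>k. c k * x ^ k)"
proof (rule summable_comparison_test')
  show "summable (\<lambda>k. inverse (fact k) * \<bar>x\<bar> ^ k)"
    by (rule summable_exp)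
  show "norm (c k * x ^ k) \<le> inverse (fact k) * \<bar>x\<bar> ^ k" for k
    using assms[of k] by (simp add: abs_mult power_abs mult_right_mono)
qed

text \<open>A crude bound suffices: with k \<le> k! it puts the coefficients harm k / (k!)^2 below
  1/k!, so the exponential series dominates.\<close>

lemma harm_le_of_nat: "harm n \<le> (of_nat n :: real)"
proof (induction n)
  case (Suc n)
  have "inverse (1 + real n) \<le> 1" by (simp add: field_simps)
  with Suc show ?case by (simp add: harm_Suc)
qed (simp add: harm_def)

section \<open>Bessel functions of order 0\<close>

text \<open>
With \<open>u = x\<^sup>2 / 4\<close> we have \<open>J\<^sub>0(x) = f(u)\<close> and
\<open>Y\<^sub>0(x) = 2/\<pi> ((ln (\<bar>x\<bar>/2) + \<gamma>) f(u) + g(u))\<close> with entire \<open>f\<close>, \<open>g\<close>; since the Euler operator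
\<open>x d/dx\<close> is \<open>2 u d/du\<close>, the Bessel equation becomes \<open>(u f')' = - f\<close>, \<open>(u g')' = - g - f'\<close>.
\<close>

definition J_coeff :: "nat \<Rightarrow> real" where
  "J_coeff k = (-1) ^ k / (fact k)\<^sup>2"

definition Y_coeff :: "nat \<Rightarrow> real" where
  "Y_coeff k = (-1) ^ (k + 1) * harm k / (fact k)\<^sup>2"

lemma J_coeff_Suc: "(of_nat (Suc k))\<^sup>2 * J_coeff (Suc k) = - J_coeff k"
  by (simp add: J_coeff_def field_simps power2_eq_square del: of_nat_Suc)

text \<open>The increment 1/(k+1) of the harmonic number produces the inhomogeneous term, which is
  the k-th coefficient of - f'.\<close>

lemma Y_coeff_Suc: "(of_nat (Suc k))\<^sup>2 * Y_coeff (Suc k) = - Y_coeff k - diffs J_coeff k"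
  by (simp add: J_coeff_def Y_coeff_def diffs_def harm_Suc field_simps power2_eq_square
      del: of_nat_Suc)

lemma summable_J_coeff: "summable (\<lambda>k. J_coeff k * x ^ k)"
proof (rule summable_powser_if_le_inverse_fact)
  fix k
  have "1 \<le> (fact k :: real)" by simp
  then have "1 * fact k \<le> (fact k :: real)\<^sup>2"
    unfolding power2_eq_square by (intro mult_right_mono) auto
  then show "\<bar>J_coeff k\<bar> \<le> inverse (fact k)"
    by (simp add: J_coeff_def power2_eq_square field_simps)
qed

lemma summable_Y_coeff: "summable (\<lambda>k. Y_coeff k * x ^ k)"
proof (rule summable_powser_if_le_inverse_fact)
  fix k
  have "harm k \<le> (fact k :: real)"
    using harm_le_of_nat[of k] fact_ge_self[of k]
    by (metis of_nat_fact of_nat_le_iff order_trans)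
  then have "harm k * fact k \<le> (fact k :: real)\<^sup>2"
    unfolding power2_eq_square by (intro mult_right_mono) auto
  then show "\<bar>Y_coeff k\<bar> \<le> inverse (fact k)"
    by (simp add: Y_coeff_def abs_mult power2_eq_square field_simps)
qed

definition J_ser :: "real \<Rightarrow> real" where "J_ser u = (\<Sum>k. J_coeff k * u ^ k)"
definition Y_ser :: "real \<Rightarrow> real" where "Y_ser u = (\<Sum>k. Y_coeff k * u ^ k)"
definition J_ser' :: "real \<Rightarrow> real" where "J_ser' u = (\<Sum>k. diffs J_coeff k * u ^ k)"
definition Y_ser' :: "real \<Rightarrow> real" where "Y_ser' u = (\<Sum>k. diffs Y_coeff k * u ^ k)"

lemma J_ser_deriv: "(J_ser has_real_derivative J_ser' u) (at u)"
  unfolding J_ser_def [abs_def] J_ser'_def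
  by (intro termdiffs_strong_converges_everywhere summable_J_coeff)

lemma Y_ser_deriv: "(Y_ser has_real_derivative Y_ser' u) (at u)"
  unfolding Y_ser_def [abs_def] Y_ser'_def
  by (intro termdiffs_strong_converges_everywhere summable_Y_coeff)

lemma euler_J_ser_deriv: "((\<lambda>u. u * J_ser' u) has_real_derivative - J_ser u) (at u)"
  using euler_operator_powser_deriv[OF summable_J_coeff, of u] summable_J_coeff[of u]
  unfolding J_ser_def J_ser'_def J_coeff_Suc by (simp add: suminf_minus)

lemma euler_Y_ser_deriv: "((\<lambda>u. u * Y_ser' u) has_real_derivative - Y_ser u - J_ser' u) (at u)"
proof -
  have "(\<Sum>k. (- Y_coeff k - diffs J_coeff k) * u ^ k) = - Y_ser u - J_ser' u"
    unfolding Y_ser_def J_ser'_def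
    using summable_Y_coeff[of u] termdiff_converges_all[OF summable_J_coeff, of u]
    by (simp add: suminf_minus suminf_diff summable_minus left_diff_distrib
        flip: suminf_minus)
  then show ?thesis
    using euler_operator_powser_deriv[OF summable_Y_coeff, of u]
    unfolding Y_ser'_def Y_coeff_Suc by simp
qed

text \<open>The products u f'(u) and u g'(u) are registered as units; \<open>J_ser'\<close> and
  \<open>Y_ser'\<close> on their own get no rule.\<close>

lemmas ser_derivs [derivative_intros] =
  J_ser_deriv[THEN DERIV_chain2] Y_ser_deriv[THEN DERIV_chain2]
  euler_J_ser_deriv[THEN DERIV_chain2] euler_Y_ser_deriv[THEN DERIV_chain2]

lemma ser_0 [simp]: "J_ser 0 = 1" "Y_ser 0 = 0"
  unfolding J_ser_def Y_ser_def powser_zero by (simp_all add: J_coeff_def Y_coeff_def harm_def)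

text \<open>The Wronskian of \<open>J\<^sub>0\<close> and \<open>Y\<^sub>0\<close>: its logarithmic terms cancel, leaving an entire function of \<open>u\<close>.\<close>

lemma ser_wronskian:
  "(J_ser u)\<^sup>2 + 2 * J_ser u * (u * Y_ser' u) - 2 * (u * J_ser' u) * Y_ser u = 1"
proof -
  let ?W = "\<lambda>u. (J_ser u)\<^sup>2 + 2 * J_ser u * (u * Y_ser' u) - 2 * (u * J_ser' u) * Y_ser u"
  \<comment> \<open>The square absorbs the source term: its derivative 2 f f' cancels the
    contribution of - f' in (u g')'. The value 1 is that of f^2 at u = 0, where the other summands
    vanish.\<close>
  have "DERIV ?W u :> 0" for u
    by (rule derivative_eq_intros refl)+ (simp add: algebra_simps)
  then have "?W u = ?W 0"
    by (intro DERIV_isconst_all) auto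
  then show ?thesis by simp
qed

text \<open>\<open>x J\<^sub>0'(x)\<close> and \<open>x Y\<^sub>0'(x)\<close>, with the junk value \<open>2/\<pi>\<close> at \<open>x = 0\<close> the limit of the latter.\<close>

definition euler_J0 :: "real \<Rightarrow> real" where
  "euler_J0 x = 2 * (x\<^sup>2 / 4 * J_ser' (x\<^sup>2 / 4))"

definition euler_Y0 :: "real \<Rightarrow> real" where
  "euler_Y0 x = 2 / pi * (J_ser (x\<^sup>2 / 4) + (ln (\<bar>x\<bar> / 2) + euler_mascheroni) * euler_J0 x
     + 2 * (x\<^sup>2 / 4 * Y_ser' (x\<^sup>2 / 4)))"

section \<open>Differential equations and Wronskian of J_0 and Y_0\<close>

lemma bessel_J0_eq: "bessel_J0 x = J_ser (x\<^sup>2 / 4)"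
  by (simp add: bessel_J0_def J_ser_def J_coeff_def)

lemma bessel_Y0_eq:
  "bessel_Y0 x = 2 / pi * ((ln (\<bar>x\<bar> / 2) + euler_mascheroni) * J_ser (x\<^sup>2 / 4) + Y_ser (x\<^sup>2 / 4))"
  by (simp add: bessel_Y0_def bessel_J0_eq Y_ser_def Y_coeff_def algebra_simps)

text \<open>Writing ln |x| as ln (x^2) / 2 removes the absolute value and with it a case split on
  the sign of x. The two forms are compared only on the open set of nonzero arguments.\<close>

lemma ln_abs_half_deriv:
  fixes x :: real
  assumes "x \<noteq> 0"
  shows "((\<lambda>x. ln (\<bar>x\<bar> / 2)) has_real_derivative 1 / x) (at x)"
proof -
  have "((\<lambda>x. ln (x\<^sup>2) / 2 - ln 2) has_real_derivative 1 / x) (at x)"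
    using assms by (auto intro!: derivative_eq_intros simp: power2_eq_square zero_less_mult_iff)
  moreover have "ln (y\<^sup>2) / 2 - ln 2 = ln (\<bar>y\<bar> / 2)" if "y \<noteq> 0" for y :: real
    using that ln_realpow[of "\<bar>y\<bar>" 2] by (simp add: ln_div)
  ultimately show ?thesis
    using assms by (elim has_field_derivative_transform_within_open[where S = "- {0}"]) auto
qed

lemma ser_quarter_square_derivs:
  fixes x :: real
  shows "((\<lambda>x. J_ser (x\<^sup>2 / 4)) has_real_derivative J_ser' (x\<^sup>2 / 4) * (x / 2)) (at x)"
    and "((\<lambda>x. Y_ser (x\<^sup>2 / 4)) has_real_derivative Y_ser' (x\<^sup>2 / 4) * (x / 2)) (at x)"
    and "((\<lambda>x. x\<^sup>2 / 4 * J_ser' (x\<^sup>2 / 4)) has_real_derivative - J_ser (x\<^sup>2 / 4) * (x / 2)) (at x)"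
    and "((\<lambda>x. x\<^sup>2 / 4 * Y_ser' (x\<^sup>2 / 4)) has_real_derivative
           (- Y_ser (x\<^sup>2 / 4) - J_ser' (x\<^sup>2 / 4)) * (x / 2)) (at x)"
proof -
  have D: "((\<lambda>x. x\<^sup>2 / 4) has_real_derivative x / 2) (at x)"
    by (auto intro!: derivative_eq_intros)
  show "((\<lambda>x. J_ser (x\<^sup>2 / 4)) has_real_derivative J_ser' (x\<^sup>2 / 4) * (x / 2)) (at x)"
    by (rule DERIV_chain2[OF J_ser_deriv D])
  show "((\<lambda>x. Y_ser (x\<^sup>2 / 4)) has_real_derivative Y_ser' (x\<^sup>2 / 4) * (x / 2)) (at x)"
    by (rule DERIV_chain2[OF Y_ser_deriv D])
  show "((\<lambda>x. x\<^sup>2 / 4 * J_ser' (x\<^sup>2 / 4)) has_real_derivative - J_ser (x\<^sup>2 / 4) * (x / 2)) (at x)"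
    by (rule DERIV_chain2[OF euler_J_ser_deriv D])
  show "((\<lambda>x. x\<^sup>2 / 4 * Y_ser' (x\<^sup>2 / 4)) has_real_derivative
           (- Y_ser (x\<^sup>2 / 4) - J_ser' (x\<^sup>2 / 4)) * (x / 2)) (at x)"
    by (rule DERIV_chain2[OF euler_Y_ser_deriv D])
qed

lemma bessel_J0_deriv:
  assumes "x \<noteq> 0"
  shows "(bessel_J0 has_real_derivative euler_J0 x / x) (at x)"
  unfolding bessel_J0_eq [abs_def]
  by (rule DERIV_cong[OF ser_quarter_square_derivs(1)])
     (use assms in \<open>simp add: euler_J0_def power2_eq_square\<close>)

text \<open>This is Bessel's equation of order 0 in self-adjoint form, (x w')' = - x w.\<close>

lemma euler_J0_deriv: "(euler_J0 has_real_derivative - x * bessel_J0 x) (at x)"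
  unfolding euler_J0_def [abs_def] bessel_J0_eq
  by (rule DERIV_cong[OF DERIV_cmult[OF ser_quarter_square_derivs(3)]]) simp

lemma bessel_Y0_deriv:
  assumes "x \<noteq> 0"
  shows "(bessel_Y0 has_real_derivative euler_Y0 x / x) (at x)"
  unfolding bessel_Y0_eq [abs_def]
  by (rule DERIV_cong[OF DERIV_cmult[OF DERIV_add[OF DERIV_mult[OF
        DERIV_add[OF ln_abs_half_deriv[OF assms] DERIV_const] ser_quarter_square_derivs(1)]
        ser_quarter_square_derivs(2)]]])
     (use assms in \<open>simp add: euler_Y0_def euler_J0_def field_simps power2_eq_square\<close>)

text \<open>The source term of g is made for this equation: differentiating f and differentiating
  the logarithm each leave x f'(u) / 2 with u = x^2/4, and the - f' in (u g')' removes both.\<close>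

lemma euler_Y0_deriv:
  assumes "x \<noteq> 0"
  shows "(euler_Y0 has_real_derivative - x * bessel_Y0 x) (at x)"
  unfolding euler_Y0_def [abs_def] bessel_Y0_eq
  by (rule DERIV_cong[OF DERIV_cmult[OF DERIV_add[OF DERIV_add[OF ser_quarter_square_derivs(1)
        DERIV_mult[OF DERIV_add[OF ln_abs_half_deriv[OF assms] DERIV_const] euler_J0_deriv]]
        DERIV_cmult[OF ser_quarter_square_derivs(4)]]]])
     (use assms in \<open>simp add: bessel_J0_eq euler_J0_def field_simps power2_eq_square\<close>)

lemma bessel_wronskian: "bessel_J0 x * euler_Y0 x - euler_J0 x * bessel_Y0 x = 2 / pi"
proof -
  have "bessel_J0 x * euler_Y0 x - euler_J0 x * bessel_Y0 x = 2 / pi *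
    ((J_ser (x\<^sup>2/4))\<^sup>2 + 2 * J_ser (x\<^sup>2/4) * (x\<^sup>2/4 * Y_ser' (x\<^sup>2/4))
      - 2 * (x\<^sup>2/4 * J_ser' (x\<^sup>2/4)) * Y_ser (x\<^sup>2/4))"
    unfolding bessel_J0_eq bessel_Y0_eq euler_Y0_def euler_J0_def
    by (simp add: algebra_simps power2_eq_square)
  then show ?thesis by (simp only: ser_wronskian mult_1_right)
qed

section \<open>The rotated state as a function of the attitude\<close>

lemma isCont_J_ser': "isCont J_ser' u"
proof -
  have "(J_ser' has_real_derivative (\<Sum>k. diffs (diffs J_coeff) k * u ^ k)) (at u)"
    unfolding J_ser'_def [abs_def]
    by (intro termdiffs_strong_converges_everywhere termdiff_converges_all summable_J_coeff)
  then show ?thesis by (rule DERIV_isCont)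
qed

text \<open>The vector \<open>Z\<close> as a function of the attitude \<open>x\<close>: for \<open>w = C\<^sub>1 J\<^sub>0 + C\<^sub>2 Y\<^sub>0\<close> it is \<open>(x w(x), x w'(x))\<close>.\<close>

definition bessel_state :: "real \<Rightarrow> real \<Rightarrow> real \<Rightarrow> real^2" where
  "bessel_state C\<^sub>1 C\<^sub>2 x =
     vector [x * (C\<^sub>1 * bessel_J0 x + C\<^sub>2 * bessel_Y0 x), C\<^sub>1 * euler_J0 x + C\<^sub>2 * euler_Y0 x]"

lemma bessel_state_nth [simp]:
  "bessel_state C\<^sub>1 C\<^sub>2 x $ 1 = x * (C\<^sub>1 * bessel_J0 x + C\<^sub>2 * bessel_Y0 x)"
  "bessel_state C\<^sub>1 C\<^sub>2 x $ 2 = C\<^sub>1 * euler_J0 x + C\<^sub>2 * euler_Y0 x"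
  by (simp_all add: bessel_state_def)

lemma bessel_state_derivs:
  assumes "x \<noteq> 0"
  shows "((\<lambda>x. bessel_state C\<^sub>1 C\<^sub>2 x $ 1) has_real_derivative
           bessel_state C\<^sub>1 C\<^sub>2 x $ 1 / x + bessel_state C\<^sub>1 C\<^sub>2 x $ 2) (at x)"
    and "((\<lambda>x. bessel_state C\<^sub>1 C\<^sub>2 x $ 2) has_real_derivative - bessel_state C\<^sub>1 C\<^sub>2 x $ 1) (at x)"
proof -
  show "((\<lambda>x. bessel_state C\<^sub>1 C\<^sub>2 x $ 1) has_real_derivative
           bessel_state C\<^sub>1 C\<^sub>2 x $ 1 / x + bessel_state C\<^sub>1 C\<^sub>2 x $ 2) (at x)"
    unfolding bessel_state_nth
    by (rule DERIV_cong[OF DERIV_mult[OF DERIV_ident DERIV_add[OF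
          DERIV_cmult[OF bessel_J0_deriv[OF assms]] DERIV_cmult[OF bessel_Y0_deriv[OF assms]]]]])
       (use assms in \<open>simp add: field_simps\<close>)
  show "((\<lambda>x. bessel_state C\<^sub>1 C\<^sub>2 x $ 2) has_real_derivative - bessel_state C\<^sub>1 C\<^sub>2 x $ 1) (at x)"
    unfolding bessel_state_nth
    by (rule DERIV_cong[OF DERIV_add[OF
          DERIV_cmult[OF euler_J0_deriv] DERIV_cmult[OF euler_Y0_deriv[OF assms]]]])
       (simp add: algebra_simps)
qed

lemma bessel_state_inj:
  assumes "x \<noteq> 0" and eq: "bessel_state C\<^sub>1 C\<^sub>2 x = bessel_state D\<^sub>1 D\<^sub>2 x"
  shows "C\<^sub>1 = D\<^sub>1" and "C\<^sub>2 = D\<^sub>2"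
proof -
  let ?J = "bessel_J0 x" and ?Y = "bessel_Y0 x" and ?J' = "euler_J0 x" and ?Y' = "euler_Y0 x"
  have 1: "C\<^sub>1 * ?J + C\<^sub>2 * ?Y = D\<^sub>1 * ?J + D\<^sub>2 * ?Y"
    using arg_cong[OF eq, of "\<lambda>z. z $ 1"] \<open>x \<noteq> 0\<close> by simp
  have 2: "C\<^sub>1 * ?J' + C\<^sub>2 * ?Y' = D\<^sub>1 * ?J' + D\<^sub>2 * ?Y'"
    using arg_cong[OF eq, of "\<lambda>z. z $ 2"] by simp
  have "(C\<^sub>1 - D\<^sub>1) * (?J * ?Y' - ?J' * ?Y) = 0" using 1 2 by algebra
  then show "C\<^sub>1 = D\<^sub>1" by (simp add: bessel_wronskian)
  have "(C\<^sub>2 - D\<^sub>2) * (?J * ?Y' - ?J' * ?Y) = 0" using 1 2 by algebra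
  then show "C\<^sub>2 = D\<^sub>2" by (simp add: bessel_wronskian)
qed

lemma bessel_state_surj:
  assumes "x \<noteq> 0"
  obtains C\<^sub>1 C\<^sub>2 where "bessel_state C\<^sub>1 C\<^sub>2 x = z"
proof
  let ?J = "bessel_J0 x" and ?Y = "bessel_Y0 x" and ?J' = "euler_J0 x" and ?Y' = "euler_Y0 x"
  define p where "p = z $ 1 / x"
  \<comment> \<open>Cramer's rule for the linear system in the two constants, the first row divided
    by x; its determinant is the Wronskian 2/\<pi>, whence the factor \<pi>/2.\<close>
  let ?C1 = "pi / 2 * (p * ?Y' - z $ 2 * ?Y)"
  let ?C2 = "pi / 2 * (z $ 2 * ?J - p * ?J')"
  have "?C1 * ?J + ?C2 * ?Y = pi / 2 * p * (?J * ?Y' - ?J' * ?Y)"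
    by (simp add: algebra_simps)
  moreover have "?C1 * ?J' + ?C2 * ?Y' = pi / 2 * z $ 2 * (?J * ?Y' - ?J' * ?Y)"
    by (simp add: algebra_simps)
  ultimately show "bessel_state ?C1 ?C2 x = z"
    using \<open>x \<noteq> 0\<close> by (simp add: vec_eq_iff forall_2 bessel_wronskian p_def)
qed

text \<open>The logarithm is unbounded at 0, so it is bundled with one power of x into
  \<open>l\<close>, which tends to 0. In the first component the factor x supplies that power. In
  the second, \<open>euler_J0\<close> is x^2/2 times a continuous function and has a power to spare;
  the surviving 2/\<pi> is the term \<open>J_ser\<close> left over from differentiating the
  logarithm.\<close>

lemma bessel_state_tendsto:
  "((\<lambda>x. bessel_state C\<^sub>1 C\<^sub>2 x $ 1) \<longlongrightarrow> 0) (at 0)"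
  "((\<lambda>x. bessel_state C\<^sub>1 C\<^sub>2 x $ 2) \<longlongrightarrow> 2 * C\<^sub>2 / pi) (at 0)"
proof -
  define l where "l x = x * ln (\<bar>x\<bar> / 2)" for x :: real
  have l: "(l \<longlongrightarrow> 0) (at 0)" unfolding l_def by real_asymp
  have J: "((\<lambda>x. J_ser (x\<^sup>2 / 4)) \<longlongrightarrow> 1) (at 0)"
    using DERIV_isCont[OF ser_quarter_square_derivs(1), of 0] by (simp add: isCont_def)
  have Y: "((\<lambda>x. Y_ser (x\<^sup>2 / 4)) \<longlongrightarrow> 0) (at 0)"
    using DERIV_isCont[OF ser_quarter_square_derivs(2), of 0] by (simp add: isCont_def)
  have eY: "((\<lambda>x. x\<^sup>2 / 4 * Y_ser' (x\<^sup>2 / 4)) \<longlongrightarrow> 0) (at 0)"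
    using DERIV_isCont[OF ser_quarter_square_derivs(4), of 0] by (simp add: isCont_def)
  have "isCont (\<lambda>x. J_ser' (x\<^sup>2 / 4)) 0"
    by (rule isCont_o2[OF _ isCont_J_ser']) (auto intro!: continuous_intros)
  then have J': "((\<lambda>x. J_ser' (x\<^sup>2 / 4)) \<longlongrightarrow> J_ser' 0) (at 0)"
    by (simp add: isCont_def)
  have id: "((\<lambda>x::real. x) \<longlongrightarrow> 0) (at 0)" by (rule tendsto_ident_at)
  have "((\<lambda>x. C\<^sub>1 * (x * J_ser (x\<^sup>2 / 4)) + C\<^sub>2 * (2 / pi * ((l x + euler_mascheroni * x) * J_ser (x\<^sup>2 / 4)
      + x * Y_ser (x\<^sup>2 / 4)))) \<longlongrightarrow>
      C\<^sub>1 * (0 * 1) + C\<^sub>2 * (2 / pi * ((0 + euler_mascheroni * 0) * 1 + 0 * 0))) (at 0)"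
    by (intro tendsto_intros l J Y id)
  moreover have "(\<lambda>x. C\<^sub>1 * (x * J_ser (x\<^sup>2 / 4)) + C\<^sub>2 * (2 / pi * ((l x + euler_mascheroni * x) * J_ser (x\<^sup>2 / 4)
      + x * Y_ser (x\<^sup>2 / 4)))) = (\<lambda>x. bessel_state C\<^sub>1 C\<^sub>2 x $ 1)"
    by (rule ext) (simp add: l_def bessel_J0_eq bessel_Y0_eq algebra_simps)
  ultimately show "((\<lambda>x. bessel_state C\<^sub>1 C\<^sub>2 x $ 1) \<longlongrightarrow> 0) (at 0)" by simp
  have "((\<lambda>x. C\<^sub>1 * (x * x / 2 * J_ser' (x\<^sup>2 / 4)) + C\<^sub>2 * (2 / pi * (J_ser (x\<^sup>2 / 4)
      + (l x + euler_mascheroni * x) * (x / 2 * J_ser' (x\<^sup>2 / 4))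
      + 2 * (x\<^sup>2 / 4 * Y_ser' (x\<^sup>2 / 4))))) \<longlongrightarrow>
      C\<^sub>1 * (0 * 0 / 2 * J_ser' 0) + C\<^sub>2 * (2 / pi * (1
      + (0 + euler_mascheroni * 0) * (0 / 2 * J_ser' 0) + 2 * 0))) (at 0)"
    by (intro tendsto_intros l J J' eY id) auto
  moreover have "(\<lambda>x. C\<^sub>1 * (x * x / 2 * J_ser' (x\<^sup>2 / 4)) + C\<^sub>2 * (2 / pi * (J_ser (x\<^sup>2 / 4)
      + (l x + euler_mascheroni * x) * (x / 2 * J_ser' (x\<^sup>2 / 4))
      + 2 * (x\<^sup>2 / 4 * Y_ser' (x\<^sup>2 / 4))))) = (\<lambda>x. bessel_state C\<^sub>1 C\<^sub>2 x $ 2)"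
    by (rule ext) (simp add: l_def euler_J0_def euler_Y0_def algebra_simps power2_eq_square)
  ultimately show "((\<lambda>x. bessel_state C\<^sub>1 C\<^sub>2 x $ 2) \<longlongrightarrow> 2 * C\<^sub>2 / pi) (at 0)"
    by (simp add: mult.commute)
qed

section \<open>The closed loop\<close>

lemma rotation_matrix_mult [simp]:
  "(rotation_matrix a *v z) $ 1 = cos a * z $ 1 - sin a * z $ 2"
  "(rotation_matrix a *v z) $ 2 = sin a * z $ 1 + cos a * z $ 2"
  by (simp_all add: rotation_matrix_def matrix_vector_mult_def sum_2)

lemma rotation_matrix_mult_minus: "rotation_matrix a *v (rotation_matrix (- a) *v z) = z"
proof -
  have cs: "cos a * (cos a * u) + sin a * (sin a * u) = u" for u
    using sin_cos_squared_add[of a] by algebra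
  show ?thesis
    by (simp add: vec_eq_iff forall_2 algebra_simps cs)
qed

text \<open>R(-\<theta>) inverts R(\<theta>), so for t \<ge> 0 the rotated coordinates are a
  function of X and \<theta>.\<close>

lemma rotated_coords_iff:
  "rotated_coords X \<theta> Z \<longleftrightarrow> (\<forall>t\<ge>0. Z t = rotation_matrix (- \<theta> t) *v X t)"
  unfolding rotated_coords_def by (metis rotation_matrix_mult_minus minus_minus)

lemma has_vector_derivative_real2_iff:
  fixes X :: "real \<Rightarrow> real^2"
  shows "(X has_vector_derivative D) (at t within S) \<longleftrightarrow>
    ((\<lambda>t. X t $ 1) has_real_derivative D $ 1) (at t within S) \<and>
    ((\<lambda>t. X t $ 2) has_real_derivative D $ 2) (at t within S)"
proof
  assume "(X has_vector_derivative D) (at t within S)"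
  then have "((\<lambda>t. X t $ i) has_vector_derivative D $ i) (at t within S)" for i
    by (rule bounded_linear.has_vector_derivative[OF bounded_linear_vec_nth])
  then show "((\<lambda>t. X t $ 1) has_real_derivative D $ 1) (at t within S) \<and>
    ((\<lambda>t. X t $ 2) has_real_derivative D $ 2) (at t within S)"
    by (simp add: has_real_derivative_iff_has_vector_derivative)
next
  assume "((\<lambda>t. X t $ 1) has_real_derivative D $ 1) (at t within S) \<and>
    ((\<lambda>t. X t $ 2) has_real_derivative D $ 2) (at t within S)"
  then have "((\<lambda>t. X t $ 1 *\<^sub>R axis 1 1 + X t $ 2 *\<^sub>R axis 2 1) has_vector_derivative
    (D $ 1 *\<^sub>R axis 1 1 + D $ 2 *\<^sub>R axis 2 1 :: real^2)) (at t within S)"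
    by (auto intro!: derivative_eq_intros)
  moreover have "v $ 1 *\<^sub>R axis 1 1 + v $ 2 *\<^sub>R axis 2 1 = v" for v :: "real^2"
    by (simp add: vec_eq_iff forall_2 axis_def)
  ultimately show "(X has_vector_derivative D) (at t within S)" by simp
qed

lemma closed_loop_iff:
  "closed_loop \<rho> X \<theta> \<longleftrightarrow>
     (\<forall>t\<ge>0.
        ((\<lambda>t. X t $ 1) has_real_derivative
           \<rho> * (X t $ 1 * cos (\<theta> t) + X t $ 2 * sin (\<theta> t)) * cos (\<theta> t)) (at t within {0..}) \<and>
        ((\<lambda>t. X t $ 2) has_real_derivative
           \<rho> * (X t $ 1 * cos (\<theta> t) + X t $ 2 * sin (\<theta> t)) * sin (\<theta> t)) (at t within {0..}) \<and>
        (\<theta> has_real_derivative \<rho> * \<theta> t) (at t within {0..}))"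
  unfolding closed_loop_def unicycle_def has_vector_derivative_real2_iff by auto

section \<open>Rescaling of time\<close>

text \<open>All right-hand sides are proportional to \<rho> and do not depend explicitly on time, so
  slowing time by c divides the gain by c.\<close>

lemma closed_loop_rescale:
  assumes "closed_loop \<rho> X \<theta>" "c > 0"
  shows "closed_loop (\<rho> / c) (\<lambda>t. X (t / c)) (\<lambda>t. \<theta> (t / c))"
proof -
  have resc: "((\<lambda>t. f (t / c)) has_real_derivative D / c) (at t within {0..})"
    if "(f has_real_derivative D) (at (t / c) within {0..})" for f D t
  proof -
    \<comment> \<open>The derivatives are one-sided at t = 0, so the chain rule is applied within
      the image of the half-line, which stays inside the half-line because c is positive.\<close>
    have "(f has_real_derivative D) (at (t / c) within (\<lambda>t. t / c) ` {0..})"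
      using that by (rule DERIV_subset) (use \<open>c > 0\<close> in auto)
    moreover have "((\<lambda>t. t / c) has_real_derivative 1 / c) (at t within {0..})"
      using \<open>c > 0\<close> by (auto intro!: derivative_eq_intros)
    ultimately show ?thesis
      using DERIV_image_chain[of f D "\<lambda>t. t / c" t "{0..}" "1 / c"] by (simp add: o_def)
  qed
  show ?thesis
    unfolding closed_loop_iff
  proof (intro allI impI)
    fix t :: real
    assume "t \<ge> 0"
    then have "t / c \<ge> 0" using \<open>c > 0\<close> by simp
    note D = assms(1)[unfolded closed_loop_iff, rule_format, OF this]
    show "((\<lambda>t. X (t / c) $ 1) has_real_derivative
           \<rho> / c * (X (t / c) $ 1 * cos (\<theta> (t / c)) + X (t / c) $ 2 * sin (\<theta> (t / c))) * cos (\<theta> (t / c))) (at t within {0..}) \<and>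
        ((\<lambda>t. X (t / c) $ 2) has_real_derivative
           \<rho> / c * (X (t / c) $ 1 * cos (\<theta> (t / c)) + X (t / c) $ 2 * sin (\<theta> (t / c))) * sin (\<theta> (t / c))) (at t within {0..}) \<and>
        ((\<lambda>t. \<theta> (t / c)) has_real_derivative \<rho> / c * \<theta> (t / c)) (at t within {0..})"
      using resc[OF D[THEN conjunct1]] resc[OF D[THEN conjunct2, THEN conjunct1]]
        resc[OF D[THEN conjunct2, THEN conjunct2]] by simp
  qed
qed

lemma closed_loop_normalize:
  assumes "\<rho> < 0"
  shows "closed_loop \<rho> X \<theta> \<longleftrightarrow> closed_loop (-1) (\<lambda>t. X (t / (- \<rho>))) (\<lambda>t. \<theta> (t / (- \<rho>)))"
proof
  assume "closed_loop \<rho> X \<theta>"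
  from closed_loop_rescale[OF this, of "- \<rho>"] assms
  show "closed_loop (-1) (\<lambda>t. X (t / (- \<rho>))) (\<lambda>t. \<theta> (t / (- \<rho>)))" by simp
next
  assume "closed_loop (-1) (\<lambda>t. X (t / (- \<rho>))) (\<lambda>t. \<theta> (t / (- \<rho>)))"
  \<comment> \<open>The factor -1/\<rho> undoes the first change of time and sends the gain -1 back
    to \<rho>.\<close>
  from closed_loop_rescale[OF this, of "- inverse \<rho>"] assms
  show "closed_loop \<rho> X \<theta>" by (simp add: divide_inverse mult.assoc)
qed

section \<open>Attitude, decay of the norm, uniqueness\<close>

lemma closed_loop_theta:
  assumes "closed_loop \<rho> X \<theta>" "t \<ge> 0"
  shows "\<theta> t = \<theta> 0 * exp (\<rho> * t)"
proof -
  have "\<exists>c. \<forall>t\<in>{0..}. \<theta> t * exp (- \<rho> * t) = c"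
  proof (rule has_field_derivative_zero_constant)
    fix t :: real
    assume "t \<in> {0..}"
    then have "(\<theta> has_real_derivative \<rho> * \<theta> t) (at t within {0..})"
      using assms(1) by (simp add: closed_loop_iff)
    then show "((\<lambda>t. \<theta> t * exp (- \<rho> * t)) has_real_derivative 0) (at t within {0..})"
      by (auto intro!: derivative_eq_intros)
  qed simp
  then obtain c where "\<And>t. t \<ge> 0 \<Longrightarrow> \<theta> t * exp (- \<rho> * t) = c" by auto
  from this[of t] this[of 0] assms(2) show ?thesis
    by (simp add: exp_minus field_simps)
qed

text \<open>The velocity is \<rho> times the projection of X onto the heading, so the squared norm
  has derivative 2 \<rho> times the square of that projection.\<close>

lemma closed_loop_norm_le:
  assumes cl: "closed_loop \<rho> X \<theta>" and "\<rho> \<le> 0" "t \<ge> 0"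
  shows "norm (X t) \<le> norm (X 0)"
proof -
  let ?V = "\<lambda>t. (X t $ 1)\<^sup>2 + (X t $ 2)\<^sup>2"
  have D: "(?V has_real_derivative 2 * \<rho> * (X t $ 1 * cos (\<theta> t) + X t $ 2 * sin (\<theta> t))\<^sup>2)
      (at t within {0..})" if "t \<ge> 0" for t
  proof -
    note D = cl[unfolded closed_loop_iff, rule_format, OF that]
    show ?thesis
      by (rule derivative_eq_intros D[THEN conjunct1] D[THEN conjunct2, THEN conjunct1] refl)+
         (simp add: algebra_simps power2_eq_square)
  qed
  have "?V t \<le> ?V 0"
  proof (rule DERIV_nonpos_imp_decreasing_open[OF \<open>t \<ge> 0\<close>])
    fix s :: real
    assume "0 < s"
    \<comment> \<open>At interior times the one-sided derivative is two-sided; the endpoint 0 is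
      covered by continuity alone.\<close>
    then have "at s within {0..} = at s"
      by (intro at_within_interior) simp
    with D[of s] \<open>0 < s\<close>
    have "(?V has_real_derivative 2 * \<rho> * (X s $ 1 * cos (\<theta> s) + X s $ 2 * sin (\<theta> s))\<^sup>2) (at s)"
      by (simp only: less_imp_le)
    moreover have "2 * \<rho> * (X s $ 1 * cos (\<theta> s) + X s $ 2 * sin (\<theta> s))\<^sup>2 \<le> 0"
      using \<open>\<rho> \<le> 0\<close> by (simp add: mult_le_0_iff)
    ultimately show "\<exists>y. (?V has_real_derivative y) (at s) \<and> y \<le> 0" by blast
  next
    have "continuous_on {0..} ?V"
      by (rule DERIV_continuous_on, rule D) simp
    then show "continuous_on {0..t} ?V" by (rule continuous_on_subset) auto
  qed
  then show ?thesis
    by (simp add: norm_vec_def L2_set_def sum_2)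
qed

text \<open>For a given attitude the system is linear in \<open>X\<close>, so the difference of two solutions is a solution.\<close>

lemma closed_loop_unique:
  assumes cl: "closed_loop \<rho> X \<theta>" "closed_loop \<rho> Y \<phi>" and "\<rho> \<le> 0"
    and init: "X 0 = Y 0" "\<theta> 0 = \<phi> 0" and "t \<ge> 0"
  shows "X t = Y t" and "\<theta> t = \<phi> t"
proof -
  have eq: "\<phi> s = \<theta> s" if "s \<ge> 0" for s
    using closed_loop_theta[OF cl(1) that] closed_loop_theta[OF cl(2) that] init by simp
  have "closed_loop \<rho> (\<lambda>t. X t - Y t) \<theta>"
    unfolding closed_loop_iff
  proof (intro allI impI conjI)
    fix s :: real
    assume "s \<ge> 0"
    note D1 = cl(1)[unfolded closed_loop_iff, rule_format, OF this]
      and D2 = cl(2)[unfolded closed_loop_iff, rule_format, OF this, unfolded eq[OF this]]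
    show "((\<lambda>t. (X t - Y t) $ 1) has_real_derivative
           \<rho> * ((X s - Y s) $ 1 * cos (\<theta> s) + (X s - Y s) $ 2 * sin (\<theta> s)) * cos (\<theta> s)) (at s within {0..})"
      using DERIV_diff[OF D1[THEN conjunct1] D2[THEN conjunct1]] by (simp add: algebra_simps)
    show "((\<lambda>t. (X t - Y t) $ 2) has_real_derivative
           \<rho> * ((X s - Y s) $ 1 * cos (\<theta> s) + (X s - Y s) $ 2 * sin (\<theta> s)) * sin (\<theta> s)) (at s within {0..})"
      using DERIV_diff[OF D1[THEN conjunct2, THEN conjunct1] D2[THEN conjunct2, THEN conjunct1]]
      by (simp add: algebra_simps)
    show "(\<theta> has_real_derivative \<rho> * \<theta> s) (at s within {0..})"
      using D1 by blast
  qed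
  from closed_loop_norm_le[OF this \<open>\<rho> \<le> 0\<close> \<open>t \<ge> 0\<close>] init show "X t = Y t" by simp
  show "\<theta> t = \<phi> t" using eq \<open>t \<ge> 0\<close> by simp
qed

section \<open>Explicit solutions and their constants\<close>

definition bessel_sol :: "real \<Rightarrow> real \<Rightarrow> real \<Rightarrow> real \<Rightarrow> real^2" where
  "bessel_sol C\<^sub>1 C\<^sub>2 \<theta>\<^sub>0 t =
     rotation_matrix (\<theta>\<^sub>0 * exp (- t)) *v bessel_state C\<^sub>1 C\<^sub>2 (\<theta>\<^sub>0 * exp (- t))"

text \<open>Chain rule along x' = - x. As \<theta>_0 is nonzero, x stays away from the singular
  point at every finite time.\<close>

lemma bessel_state_exp_derivs:
  assumes "\<theta>\<^sub>0 \<noteq> 0"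
  defines "x \<equiv> \<lambda>t. \<theta>\<^sub>0 * exp (- t)"
  shows "((\<lambda>t. bessel_state C\<^sub>1 C\<^sub>2 (x t) $ 1) has_real_derivative
           - bessel_state C\<^sub>1 C\<^sub>2 (x t) $ 1 - x t * bessel_state C\<^sub>1 C\<^sub>2 (x t) $ 2) (at t within S)"
    and "((\<lambda>t. bessel_state C\<^sub>1 C\<^sub>2 (x t) $ 2) has_real_derivative
           x t * bessel_state C\<^sub>1 C\<^sub>2 (x t) $ 1) (at t within S)"
    and "(x has_real_derivative - x t) (at t within S)"
proof -
  have x: "(x has_real_derivative - x t) (at t within S)"
    unfolding x_def by (auto intro!: derivative_eq_intros)
  then show "(x has_real_derivative - x t) (at t within S)" .
  have "x t \<noteq> 0" using assms by simp
  note D = DERIV_chain2[OF bessel_state_derivs(1)[OF this] x] DERIV_chain2[OF bessel_state_derivs(2)[OF this] x]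
  show "((\<lambda>t. bessel_state C\<^sub>1 C\<^sub>2 (x t) $ 1) has_real_derivative
           - bessel_state C\<^sub>1 C\<^sub>2 (x t) $ 1 - x t * bessel_state C\<^sub>1 C\<^sub>2 (x t) $ 2) (at t within S)"
    by (rule DERIV_cong[OF D(1)]) (use \<open>x t \<noteq> 0\<close> in \<open>simp add: field_simps del: bessel_state_nth\<close>)
  show "((\<lambda>t. bessel_state C\<^sub>1 C\<^sub>2 (x t) $ 2) has_real_derivative
           x t * bessel_state C\<^sub>1 C\<^sub>2 (x t) $ 1) (at t within S)"
    by (rule DERIV_cong[OF D(2)]) simp
qed

text \<open>In the rotating frame the projection of X onto the heading is z_1. The coupling terms -
  x z_2 and x z_1 of the derivative of Z compensate the turning of R(x), which leaves the velocity -
  z_1 along the heading.\<close>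

lemma closed_loop_bessel_sol:
  assumes "\<theta>\<^sub>0 \<noteq> 0"
  shows "closed_loop (-1) (bessel_sol C\<^sub>1 C\<^sub>2 \<theta>\<^sub>0) (\<lambda>t. \<theta>\<^sub>0 * exp (- t))"
  unfolding closed_loop_iff
proof (intro allI impI)
  fix t :: real
  define x where "x = (\<lambda>t. \<theta>\<^sub>0 * exp (- t))"
  define z where "z = (\<lambda>t. bessel_state C\<^sub>1 C\<^sub>2 (x t))"
  have sol: "bessel_sol C\<^sub>1 C\<^sub>2 \<theta>\<^sub>0 = (\<lambda>t. rotation_matrix (x t) *v z t)"
    by (rule ext) (simp add: bessel_sol_def x_def z_def)
  have z1: "((\<lambda>t. z t $ 1) has_real_derivative - z t $ 1 - x t * z t $ 2) (at t within {0..})"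
    and z2: "((\<lambda>t. z t $ 2) has_real_derivative x t * z t $ 1) (at t within {0..})"
    and x: "(x has_real_derivative - x t) (at t within {0..})"
    using bessel_state_exp_derivs[OF assms] unfolding x_def z_def by blast+
  have cs: "cos (x t) * (cos (x t) * u) + sin (x t) * (sin (x t) * u) = u" for u
    using sin_cos_squared_add[of "x t"] by algebra
  have inner: "(cos (x t) * z t $ 1 - sin (x t) * z t $ 2) * cos (x t)
      + (sin (x t) * z t $ 1 + cos (x t) * z t $ 2) * sin (x t) = z t $ 1"
    by (simp add: algebra_simps cs)
  note c = DERIV_cos[THEN DERIV_chain2, OF x] and s = DERIV_sin[THEN DERIV_chain2, OF x]
  show "((\<lambda>t. bessel_sol C\<^sub>1 C\<^sub>2 \<theta>\<^sub>0 t $ 1) has_real_derivative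
       -1 * (bessel_sol C\<^sub>1 C\<^sub>2 \<theta>\<^sub>0 t $ 1 * cos (\<theta>\<^sub>0 * exp (- t))
           + bessel_sol C\<^sub>1 C\<^sub>2 \<theta>\<^sub>0 t $ 2 * sin (\<theta>\<^sub>0 * exp (- t))) * cos (\<theta>\<^sub>0 * exp (- t))) (at t within {0..}) \<and>
     ((\<lambda>t. bessel_sol C\<^sub>1 C\<^sub>2 \<theta>\<^sub>0 t $ 2) has_real_derivative
       -1 * (bessel_sol C\<^sub>1 C\<^sub>2 \<theta>\<^sub>0 t $ 1 * cos (\<theta>\<^sub>0 * exp (- t))
           + bessel_sol C\<^sub>1 C\<^sub>2 \<theta>\<^sub>0 t $ 2 * sin (\<theta>\<^sub>0 * exp (- t))) * sin (\<theta>\<^sub>0 * exp (- t))) (at t within {0..}) \<and>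
     ((\<lambda>t. \<theta>\<^sub>0 * exp (- t)) has_real_derivative -1 * (\<theta>\<^sub>0 * exp (- t))) (at t within {0..})"
    unfolding sol rotation_matrix_mult
    unfolding x_def[symmetric, THEN fun_cong] inner
  proof (intro conjI)
    show "((\<lambda>t. cos (x t) * z t $ 1 - sin (x t) * z t $ 2) has_real_derivative
        -1 * z t $ 1 * cos (x t)) (at t within {0..})"
      by (rule DERIV_cong[OF DERIV_diff[OF DERIV_mult[OF c z1] DERIV_mult[OF s z2]]]) (simp add: algebra_simps)
    show "((\<lambda>t. sin (x t) * z t $ 1 + cos (x t) * z t $ 2) has_real_derivative
        -1 * z t $ 1 * sin (x t)) (at t within {0..})"
      by (rule DERIV_cong[OF DERIV_add[OF DERIV_mult[OF s z1] DERIV_mult[OF c z2]]]) (simp add: algebra_simps)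
    show "(x has_real_derivative -1 * x t) (at t within {0..})" using x by simp
  qed
qed

text \<open>The formula for z_2 is a quotient of derivatives that are only asserted to exist. They
  are unique and the denominator - \<theta> is nonzero, so solving z_1' = - z_1 - \<theta> z_2 for
  z_2 shows that the quotient is the second component of \<open>bessel_state\<close>.\<close>

lemma bessel_form_iff:
  assumes "\<theta>\<^sub>0 \<noteq> 0"
  shows "bessel_form \<theta>\<^sub>0 C\<^sub>1 C\<^sub>2 \<theta> Z \<longleftrightarrow>
    (\<forall>t\<ge>0. \<theta> t = \<theta>\<^sub>0 * exp (- t) \<and> Z t = bessel_state C\<^sub>1 C\<^sub>2 (\<theta>\<^sub>0 * exp (- t)))"
    (is "?L \<longleftrightarrow> ?R")
proof -
  let ?x = "\<lambda>t. \<theta>\<^sub>0 * exp (- t)"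
  let ?s = "\<lambda>t. bessel_state C\<^sub>1 C\<^sub>2 (?x t)"
  let ?d1 = "\<lambda>t. - ?s t $ 1 - ?x t * ?s t $ 2"
  have snd: "(?d1 t + ?s t $ 1) / (- ?x t) = ?s t $ 2" for t
    using assms by (simp del: bessel_state_nth)
  have D: "(\<theta> has_real_derivative - ?x t) (at t within {0..})"
      "((\<lambda>s. Z s $ 1) has_real_derivative ?d1 t) (at t within {0..})"
    if "t \<ge> 0" and eq: "\<And>t. t \<ge> 0 \<Longrightarrow> \<theta> t = ?x t \<and> Z t $ 1 = ?s t $ 1" for t
  proof -
    show "(\<theta> has_real_derivative - ?x t) (at t within {0..})"
      by (rule has_field_derivative_transform_within[OF bessel_state_exp_derivs(3)[OF assms] zero_less_one])
         (use that in auto)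
    show "((\<lambda>s. Z s $ 1) has_real_derivative ?d1 t) (at t within {0..})"
      by (rule has_field_derivative_transform_within[OF bessel_state_exp_derivs(1)[OF assms] zero_less_one])
         (use that in auto)
  qed
  show ?thesis
  proof
    assume L: ?L
    then have eq: "\<theta> t = ?x t \<and> Z t $ 1 = ?s t $ 1" if "t \<ge> 0" for t
      using that unfolding bessel_form_def by (auto dest!: spec[of _ t])
    show ?R
    proof (intro allI impI conjI)
      fix t :: real
      assume t: "t \<ge> 0"
      then show "\<theta> t = ?x t" using eq by blast
      from L t obtain d1 d2 where d: "((\<lambda>s. Z s $ 1) has_real_derivative d1) (at t within {0..})"
        "(\<theta> has_real_derivative d2) (at t within {0..})" "Z t $ 2 = (d1 + Z t $ 1) / d2"
        unfolding bessel_form_def by blast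
      \<comment> \<open>Uniqueness of derivatives needs t to be a limit point of the half-line,
        which matters at t = 0.\<close>
      have nb: "at t within {0..} \<noteq> bot"
      proof -
        have "at_right t \<le> at t within {0..}" by (rule at_le) (use t in auto)
        then show ?thesis by (metis le_bot trivial_limit_at_right_real)
      qed
      have "d1 = ?d1 t"
        using has_field_derivative_unique[OF d(1) D(2)[OF t eq] nb] .
      moreover have "d2 = - ?x t"
        using has_field_derivative_unique[OF d(2) D(1)[OF t eq] nb] .
      ultimately show "Z t = ?s t"
        using d(3) eq[OF t] snd[of t] unfolding vec_eq_iff forall_2 by metis
    qed
  next
    assume R: ?R
    then have eq: "\<theta> t = ?x t \<and> Z t $ 1 = ?s t $ 1" if "t \<ge> 0" for t
      using that by simp
    show ?L
      unfolding bessel_form_def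
    proof (intro allI impI)
      fix t :: real
      assume t: "t \<ge> 0"
      have "Z t $ 2 = (?d1 t + Z t $ 1) / (- ?x t)"
        using R t snd[of t] by metis
      then show "\<theta> t = ?x t \<and>
        Z t $ 1 = \<theta> t * (C\<^sub>1 * bessel_J0 (\<theta> t) + C\<^sub>2 * bessel_Y0 (\<theta> t)) \<and>
        (\<exists>d1 d2. ((\<lambda>s. Z s $ 1) has_real_derivative d1) (at t within {0..}) \<and>
                 (\<theta> has_real_derivative d2) (at t within {0..}) \<and>
                 Z t $ 2 = (d1 + Z t $ 1) / d2)"
        using D[OF t eq] eq[OF t] bessel_state_nth(1) by metis
    qed
  qed
qed

lemma bessel_sol_tendsto:
  assumes "\<theta>\<^sub>0 \<noteq> 0"
  shows "((\<lambda>t. bessel_state C\<^sub>1 C\<^sub>2 (\<theta>\<^sub>0 * exp (- t)) $ 1) \<longlongrightarrow> 0) at_top"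
    and "((\<lambda>t. bessel_state C\<^sub>1 C\<^sub>2 (\<theta>\<^sub>0 * exp (- t)) $ 2) \<longlongrightarrow> 2 * C\<^sub>2 / pi) at_top"
    and "(bessel_sol C\<^sub>1 C\<^sub>2 \<theta>\<^sub>0 \<longlongrightarrow> vector [0, 2 * C\<^sub>2 / pi]) at_top"
proof -
  let ?x = "\<lambda>t. \<theta>\<^sub>0 * exp (- t)"
  have x: "(?x \<longlongrightarrow> 0) at_top"
    by (rule tendsto_mult_right_zero) real_asymp
  \<comment> \<open>The limits at 0 are punctured, so the attitude must avoid the value 0 on its way
    there.\<close>
  then have "filterlim ?x (at 0) at_top"
    using assms by (intro filterlim_atI) auto
  note lim = bessel_state_tendsto[THEN filterlim_compose, OF this]
  show z1: "((\<lambda>t. bessel_state C\<^sub>1 C\<^sub>2 (?x t) $ 1) \<longlongrightarrow> 0) at_top"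
    and z2: "((\<lambda>t. bessel_state C\<^sub>1 C\<^sub>2 (?x t) $ 2) \<longlongrightarrow> 2 * C\<^sub>2 / pi) at_top"
    by (rule lim)+
  have c: "((\<lambda>t. cos (?x t)) \<longlongrightarrow> 1) at_top" and s: "((\<lambda>t. sin (?x t)) \<longlongrightarrow> 0) at_top"
    using tendsto_cos[OF x] tendsto_sin[OF x] by simp_all
  show "(bessel_sol C\<^sub>1 C\<^sub>2 \<theta>\<^sub>0 \<longlongrightarrow> vector [0, 2 * C\<^sub>2 / pi]) at_top"
  proof (rule vec_tendstoI)
    fix i :: 2
    have "((\<lambda>t. bessel_sol C\<^sub>1 C\<^sub>2 \<theta>\<^sub>0 t $ 1) \<longlongrightarrow> 1 * 0 - 0 * (2 * C\<^sub>2 / pi)) at_top"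
      unfolding bessel_sol_def rotation_matrix_mult by (intro tendsto_intros c s z1 z2)
    moreover have "((\<lambda>t. bessel_sol C\<^sub>1 C\<^sub>2 \<theta>\<^sub>0 t $ 2) \<longlongrightarrow> 0 * 0 + 1 * (2 * C\<^sub>2 / pi)) at_top"
      unfolding bessel_sol_def rotation_matrix_mult by (intro tendsto_intros c s z1 z2)
    ultimately show "((\<lambda>t. bessel_sol C\<^sub>1 C\<^sub>2 \<theta>\<^sub>0 t $ i) \<longlongrightarrow> (vector [0, 2 * C\<^sub>2 / pi] :: real^2) $ i) at_top"
      using exhaust_2[of i] by auto
  qed
qed

lemma bessel_sol_surj:
  assumes "\<theta>\<^sub>0 \<noteq> 0"
  obtains C\<^sub>1 C\<^sub>2 where "bessel_sol C\<^sub>1 C\<^sub>2 \<theta>\<^sub>0 0 = X\<^sub>0"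
proof -
  obtain C\<^sub>1 C\<^sub>2 where "bessel_state C\<^sub>1 C\<^sub>2 \<theta>\<^sub>0 = rotation_matrix (- \<theta>\<^sub>0) *v X\<^sub>0"
    using bessel_state_surj[OF assms] .
  then have "bessel_sol C\<^sub>1 C\<^sub>2 \<theta>\<^sub>0 0 = X\<^sub>0"
    by (simp add: bessel_sol_def rotation_matrix_mult_minus)
  then show thesis by (rule that)
qed

text \<open>The case that the Bessel representation misses: the heading is fixed along the x_c axis,
  so x_c decays and y_c is frozen. For a = 0 these are equilibria.\<close>

lemma closed_loop_zero_attitude: "closed_loop (-1) (\<lambda>t. vector [a * exp (- t), b]) (\<lambda>t. 0)"
  unfolding closed_loop_iff
proof (intro allI impI conjI)
  fix t :: real
  show "((\<lambda>t. vector [a * exp (- t), b] $ 1) has_real_derivative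
       -1 * (vector [a * exp (- t), b] $ 1 * cos 0 + vector [a * exp (- t), b] $ 2 * sin 0) * cos 0) (at t within {0..})"
    unfolding vector_2 by (auto intro!: derivative_eq_intros)
qed simp_all

lemma closed_loop_exists: "\<exists>X \<theta>. closed_loop (-1) X \<theta> \<and> X 0 = X\<^sub>0 \<and> \<theta> 0 = \<theta>\<^sub>0"
proof (cases "\<theta>\<^sub>0 = 0")
  case True
  have "vector [X\<^sub>0 $ 1 * exp (- 0), X\<^sub>0 $ 2] = X\<^sub>0"
    by (simp add: vec_eq_iff forall_2)
  with True show ?thesis
    using closed_loop_zero_attitude[of "X\<^sub>0 $ 1" "X\<^sub>0 $ 2"] by blast
next
  case False
  then obtain C\<^sub>1 C\<^sub>2 where "bessel_sol C\<^sub>1 C\<^sub>2 \<theta>\<^sub>0 0 = X\<^sub>0"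
    by (rule bessel_sol_surj)
  then show ?thesis
    using closed_loop_bessel_sol[OF False, of C\<^sub>1 C\<^sub>2]
    by (intro exI[of _ "bessel_sol C\<^sub>1 C\<^sub>2 \<theta>\<^sub>0"] exI[of _ "\<lambda>t. \<theta>\<^sub>0 * exp (- t)"]) simp
qed

lemma closed_loop_eq_bessel_sol:
  assumes "\<theta>\<^sub>0 \<noteq> 0" "closed_loop (-1) X \<theta>" "\<theta> 0 = \<theta>\<^sub>0" "X 0 = bessel_sol C\<^sub>1 C\<^sub>2 \<theta>\<^sub>0 0" "t \<ge> 0"
  shows "X t = bessel_sol C\<^sub>1 C\<^sub>2 \<theta>\<^sub>0 t" and "\<theta> t = \<theta>\<^sub>0 * exp (- t)"
proof -
  have init: "\<theta> 0 = \<theta>\<^sub>0 * exp (- 0)" "(-1 :: real) \<le> 0" using assms(3) by simp_all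
  show "X t = bessel_sol C\<^sub>1 C\<^sub>2 \<theta>\<^sub>0 t" and "\<theta> t = \<theta>\<^sub>0 * exp (- t)"
    using closed_loop_unique[OF assms(2) closed_loop_bessel_sol[OF assms(1)] init(2) assms(4) init(1) assms(5)] .
qed

lemma rotated_coords_bessel_sol:
  "rotated_coords (bessel_sol C\<^sub>1 C\<^sub>2 \<theta>\<^sub>0) (\<lambda>t. \<theta>\<^sub>0 * exp (- t)) (\<lambda>t. bessel_state C\<^sub>1 C\<^sub>2 (\<theta>\<^sub>0 * exp (- t)))"
  by (simp add: rotated_coords_def bessel_sol_def)

text \<open>Existence of the constants rests on uniqueness of solutions: every solution from the
  given data is the explicit one. Uniqueness of the constants needs at least one actual solution,
  since otherwise the implication would hold vacuously for every pair.\<close>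

lemma ex1_bessel_constants:
  assumes "\<theta>\<^sub>0 \<noteq> 0"
  shows "\<exists>!C. \<forall>X \<theta> Z.
           closed_loop (-1) X \<theta> \<and> X 0 = X\<^sub>0 \<and> \<theta> 0 = \<theta>\<^sub>0 \<and> rotated_coords X \<theta> Z \<longrightarrow>
           bessel_form \<theta>\<^sub>0 (fst C) (snd C) \<theta> Z"
proof -
  obtain C\<^sub>1 C\<^sub>2 where C: "bessel_sol C\<^sub>1 C\<^sub>2 \<theta>\<^sub>0 0 = X\<^sub>0"
    using bessel_sol_surj[OF assms] .
  show ?thesis
  proof (rule ex1I[of _ "(C\<^sub>1, C\<^sub>2)"], intro allI impI, elim conjE)
    fix X \<theta> Z
    assume cl: "closed_loop (-1) X \<theta>" and X: "X 0 = X\<^sub>0" "\<theta> 0 = \<theta>\<^sub>0" and rot: "rotated_coords X \<theta> Z"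
    have init: "X 0 = bessel_sol C\<^sub>1 C\<^sub>2 \<theta>\<^sub>0 0" using C X(1) by metis
    note eq = closed_loop_eq_bessel_sol[OF assms cl X(2) init]
    have "Z t = bessel_state C\<^sub>1 C\<^sub>2 (\<theta>\<^sub>0 * exp (- t))" if "t \<ge> 0" for t
    proof -
      have "Z t = rotation_matrix (- \<theta> t) *v X t"
        using rot that unfolding rotated_coords_iff by blast
      also have "\<dots> = rotation_matrix (- (\<theta>\<^sub>0 * exp (- t))) *v bessel_sol C\<^sub>1 C\<^sub>2 \<theta>\<^sub>0 t"
        by (simp only: eq[OF that])
      also have "\<dots> = bessel_state C\<^sub>1 C\<^sub>2 (\<theta>\<^sub>0 * exp (- t))"
        using rotated_coords_bessel_sol[of C\<^sub>1 C\<^sub>2 \<theta>\<^sub>0] that unfolding rotated_coords_iff by metis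
      finally show ?thesis .
    qed
    with eq show "bessel_form \<theta>\<^sub>0 (fst (C\<^sub>1, C\<^sub>2)) (snd (C\<^sub>1, C\<^sub>2)) \<theta> Z"
      unfolding bessel_form_iff[OF assms] fst_conv snd_conv by blast
  next
    fix D
    assume D: "\<forall>X \<theta> Z. closed_loop (-1) X \<theta> \<and> X 0 = X\<^sub>0 \<and> \<theta> 0 = \<theta>\<^sub>0 \<and> rotated_coords X \<theta> Z \<longrightarrow>
        bessel_form \<theta>\<^sub>0 (fst D) (snd D) \<theta> Z"
    have "bessel_form \<theta>\<^sub>0 (fst D) (snd D) (\<lambda>t. \<theta>\<^sub>0 * exp (- t))
        (\<lambda>t. bessel_state C\<^sub>1 C\<^sub>2 (\<theta>\<^sub>0 * exp (- t)))"
      \<comment> \<open>The competing pair is tested on the explicit solution; comparing the two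
        representations at t = 0 then gives equality by injectivity.\<close>
      by (rule D[rule_format, of "bessel_sol C\<^sub>1 C\<^sub>2 \<theta>\<^sub>0"])
         (simp add: closed_loop_bessel_sol[OF assms, of C\<^sub>1 C\<^sub>2] C rotated_coords_bessel_sol[of C\<^sub>1 C\<^sub>2 \<theta>\<^sub>0])
    then have "bessel_state C\<^sub>1 C\<^sub>2 (\<theta>\<^sub>0 * exp (- 0)) = bessel_state (fst D) (snd D) (\<theta>\<^sub>0 * exp (- 0))"
      unfolding bessel_form_iff[OF assms] by blast
    then have "bessel_state C\<^sub>1 C\<^sub>2 \<theta>\<^sub>0 = bessel_state (fst D) (snd D) \<theta>\<^sub>0"
      by simp
    from bessel_state_inj[OF assms this] show "D = (C\<^sub>1, C\<^sub>2)"
      by (simp add: prod_eq_iff)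
  qed
qed

text \<open>Solutions are constrained only for t \<ge> 0, so identities between them hold only
  there.\<close>

lemma tendsto_at_top_cong_nonneg:
  fixes f g :: "real \<Rightarrow> 'a::topological_space"
  assumes "(f \<longlongrightarrow> L) at_top" "\<And>t. t \<ge> 0 \<Longrightarrow> g t = f t"
  shows "(g \<longlongrightarrow> L) at_top"
proof (rule Lim_transform_eventually[OF assms(1)])
  show "\<forall>\<^sub>F t in at_top. f t = g t"
    by (rule eventually_mono[OF eventually_ge_at_top[of 0]]) (metis assms(2))
qed

section \<open>Limits and attractors\<close>

lemma bessel_form_tendsto:
  assumes "\<theta>\<^sub>0 \<noteq> 0" "rotated_coords X \<theta> Z" "bessel_form \<theta>\<^sub>0 C\<^sub>1 C\<^sub>2 \<theta> Z"
  shows "((\<lambda>t. Z t $ 1) \<longlongrightarrow> 0) at_top"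
    and "((\<lambda>t. Z t $ 2) \<longlongrightarrow> 2 * C\<^sub>2 / pi) at_top"
    and "(X \<longlongrightarrow> vector [0, 2 * C\<^sub>2 / pi]) at_top"
proof -
  have Z: "\<theta> t = \<theta>\<^sub>0 * exp (- t)" "Z t = bessel_state C\<^sub>1 C\<^sub>2 (\<theta>\<^sub>0 * exp (- t))" if "t \<ge> 0" for t
    using assms(3) that by (auto simp: bessel_form_iff[OF assms(1)])
  then have X: "X t = bessel_sol C\<^sub>1 C\<^sub>2 \<theta>\<^sub>0 t" if "t \<ge> 0" for t
    using assms(2) that by (simp add: rotated_coords_def bessel_sol_def)
  note lim = bessel_sol_tendsto[OF assms(1), of C\<^sub>1 C\<^sub>2]
  show "((\<lambda>t. Z t $ 1) \<longlongrightarrow> 0) at_top"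
    by (rule tendsto_at_top_cong_nonneg[OF lim(1)]) (simp add: Z)
  show "((\<lambda>t. Z t $ 2) \<longlongrightarrow> 2 * C\<^sub>2 / pi) at_top"
    by (rule tendsto_at_top_cong_nonneg[OF lim(2)]) (simp add: Z)
  show "(X \<longlongrightarrow> vector [0, 2 * C\<^sub>2 / pi]) at_top"
    by (rule tendsto_at_top_cong_nonneg[OF lim(3)]) (simp add: X)
qed

lemma tendsto_at_top_rescale_iff:
  fixes X :: "real \<Rightarrow> 'a::topological_space"
  assumes "c > 0"
  shows "((\<lambda>t. X (t / c)) \<longlongrightarrow> L) at_top \<longleftrightarrow> (X \<longlongrightarrow> L) at_top"
proof -
  have *: "((\<lambda>t. X (t / c)) \<longlongrightarrow> L) at_top" if "(X \<longlongrightarrow> L) at_top" "c > 0"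
    for c and X :: "real \<Rightarrow> 'a"
  proof (rule filterlim_compose[OF that(1)])
    show "filterlim (\<lambda>t. t / c) at_top at_top" using that(2) by real_asymp
  qed
  show ?thesis
    using *[of X c] *[of "\<lambda>t. X (t / c)" "inverse c"] assms by auto
qed

text \<open>This covers all initial data, zero attitude included, and so provides both one inclusion
  for the attractor set and the attractivity of x_c.\<close>

lemma closed_loop_tendsto:
  assumes "closed_loop (-1) X \<theta>"
  shows "\<exists>y. (X \<longlongrightarrow> vector [0, y]) at_top"
proof (cases "\<theta> 0 = 0")
  case True
  let ?Y = "\<lambda>t. vector [X 0 $ 1 * exp (- t), X 0 $ 2] :: real^2"
  have init: "X 0 = ?Y 0" by (simp add: vec_eq_iff forall_2)
  have eq: "X t = ?Y t" if "t \<ge> 0" for t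
    by (rule closed_loop_unique(1)[OF assms closed_loop_zero_attitude _ init True that]) simp
  have "(?Y \<longlongrightarrow> vector [0, X 0 $ 2]) at_top"
  proof (rule vec_tendstoI)
    have "((\<lambda>t. X 0 $ 1 * exp (- t)) \<longlongrightarrow> 0) at_top"
      by (rule tendsto_mult_right_zero) real_asymp
    then show "((\<lambda>t. ?Y t $ i) \<longlongrightarrow> (vector [0, X 0 $ 2] :: real^2) $ i) at_top" for i
      using exhaust_2[of i] by auto
  qed
  from tendsto_at_top_cong_nonneg[OF this eq] show ?thesis by blast
next
  case False
  obtain C\<^sub>1 C\<^sub>2 where "bessel_sol C\<^sub>1 C\<^sub>2 (\<theta> 0) 0 = X 0"
    using bessel_sol_surj[OF False] .
  note eq = closed_loop_eq_bessel_sol(1)[OF False assms refl this[symmetric]]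
  from tendsto_at_top_cong_nonneg[OF bessel_sol_tendsto(3)[OF False] eq] show ?thesis by blast
qed

lemma vector_0_eq_iff: "(L :: real^2) $ 1 = 0 \<longleftrightarrow> (\<exists>y. L = vector [0, y])"
proof
  assume "L $ 1 = 0"
  then have "L = vector [0, L $ 2]" by (simp add: vec_eq_iff forall_2)
  then show "\<exists>y. L = vector [0, y]" ..
qed auto

lemma attractors_fromI:
  assumes "closed_loop \<rho> X \<theta>" "\<theta> 0 = \<theta>\<^sub>0" "(X \<longlongrightarrow> L) at_top"
  shows "L \<in> attractors_from \<rho> \<theta>\<^sub>0"
  using assms unfolding attractors_from_def by blast

lemma attractors_from_normalize:
  assumes "\<rho> < 0"
  shows "attractors_from \<rho> \<theta>\<^sub>0 = attractors_from (-1) \<theta>\<^sub>0"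
proof -
  have c: "- \<rho> > 0" "inverse (- \<rho>) > 0" using assms by auto
  show ?thesis
  proof (intro equalityI subsetI)
    fix L assume "L \<in> attractors_from \<rho> \<theta>\<^sub>0"
    then obtain X \<theta> where "closed_loop \<rho> X \<theta>" "\<theta> 0 = \<theta>\<^sub>0" "(X \<longlongrightarrow> L) at_top"
      by (auto simp: attractors_from_def)
    then show "L \<in> attractors_from (-1) \<theta>\<^sub>0"
      using closed_loop_normalize[OF assms] tendsto_at_top_rescale_iff[OF c(1), of X]
      by (intro attractors_fromI[of "-1" "\<lambda>t. X (t / (- \<rho>))" "\<lambda>t. \<theta> (t / (- \<rho>))"]) auto
  next
    fix L assume "L \<in> attractors_from (-1) \<theta>\<^sub>0"
    then obtain X \<theta> where X: "closed_loop (-1) X \<theta>" "\<theta> 0 = \<theta>\<^sub>0" "(X \<longlongrightarrow> L) at_top"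
      by (auto simp: attractors_from_def)
    have "closed_loop \<rho> (\<lambda>t. X (t / inverse (- \<rho>))) (\<lambda>t. \<theta> (t / inverse (- \<rho>)))"
    proof -
      have "-1 / inverse (- \<rho>) = \<rho>" using assms by (simp add: field_simps)
      with closed_loop_rescale[OF X(1) c(2)] show ?thesis by metis
    qed
    moreover have "((\<lambda>t. X (t / inverse (- \<rho>))) \<longlongrightarrow> L) at_top"
      using X(3) unfolding tendsto_at_top_rescale_iff[OF c(2)] .
    ultimately show "L \<in> attractors_from \<rho> \<theta>\<^sub>0"
      using X(2)
      by (intro attractors_fromI[of \<rho> "\<lambda>t. X (t / inverse (- \<rho>))" "\<lambda>t. \<theta> (t / inverse (- \<rho>))"]) simp_all
  qed
qed

lemma attractors_from_eq:
  assumes "\<rho> < 0"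
  shows "attractors_from \<rho> \<theta>\<^sub>0 = {L. L $ 1 = 0}"
  unfolding attractors_from_normalize[OF assms]
proof (intro equalityI subsetI)
  fix L assume "L \<in> attractors_from (-1) \<theta>\<^sub>0"
  then obtain X \<theta> where "closed_loop (-1) X \<theta>" and L: "(X \<longlongrightarrow> L) at_top"
    by (auto simp: attractors_from_def)
  then obtain y where "(X \<longlongrightarrow> vector [0, y]) at_top"
    using closed_loop_tendsto by blast
  with L have "L = vector [0, y]"
    using tendsto_unique trivial_limit_at_top_linorder by blast
  then show "L \<in> {L. L $ 1 = 0}" by simp
next
  fix L :: "real^2"
  assume "L \<in> {L. L $ 1 = 0}"
  then obtain y where L: "L = vector [0, y]" by (auto simp: vector_0_eq_iff)
  show "L \<in> attractors_from (-1) \<theta>\<^sub>0"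
  proof (cases "\<theta>\<^sub>0 = 0")
    case True
    have "closed_loop (-1) (\<lambda>t. L) (\<lambda>t. 0)"
      using closed_loop_zero_attitude[of 0 y] L by simp
    then show ?thesis
      using True by (intro attractors_fromI[of _ "\<lambda>t. L" "\<lambda>t. 0"]) auto
  next
    case False
    \<comment> \<open>The second constant solves 2 C_2/\<pi> = y; the first does not influence the
      limit and is set to 0.\<close>
    have "(bessel_sol 0 (pi * y / 2) \<theta>\<^sub>0 \<longlongrightarrow> L) at_top"
      using bessel_sol_tendsto(3)[OF False, of 0 "pi * y / 2"] L by simp
    then show ?thesis
      by (intro attractors_fromI[OF closed_loop_bessel_sol[OF False]]) auto
  qed
qed

text \<open>The state is linear in the constants, so C_2 = 0 leaves a line of initial positions. The
  position belonging to the constants (0, 1) lies off this line by injectivity.\<close>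

lemma zero_C2_initial_positions_neq_UNIV:
  assumes "\<theta>\<^sub>0 \<noteq> 0"
  shows "{X 0 |X \<theta> Z C\<^sub>1. closed_loop (-1) X \<theta> \<and> rotated_coords X \<theta> Z \<and> bessel_form \<theta>\<^sub>0 C\<^sub>1 0 \<theta> Z} \<noteq> UNIV"
proof
  assume "{X 0 |X \<theta> Z C\<^sub>1. closed_loop (-1) X \<theta> \<and> rotated_coords X \<theta> Z \<and> bessel_form \<theta>\<^sub>0 C\<^sub>1 0 \<theta> Z} = UNIV"
  then have "bessel_sol 0 1 \<theta>\<^sub>0 0 \<in>
      {X 0 |X \<theta> Z C\<^sub>1. closed_loop (-1) X \<theta> \<and> rotated_coords X \<theta> Z \<and> bessel_form \<theta>\<^sub>0 C\<^sub>1 0 \<theta> Z}"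
    by simp
  then obtain X \<theta> Z C\<^sub>1 where X: "bessel_sol 0 1 \<theta>\<^sub>0 0 = X 0" "rotated_coords X \<theta> Z"
      "bessel_form \<theta>\<^sub>0 C\<^sub>1 0 \<theta> Z"
    by blast
  have "\<theta> 0 = \<theta>\<^sub>0" "Z 0 = bessel_state C\<^sub>1 0 \<theta>\<^sub>0"
    using X(3) by (auto simp: bessel_form_iff[OF assms] dest: spec[of _ 0])
  moreover have "bessel_state 0 1 \<theta>\<^sub>0 = rotation_matrix (- \<theta>\<^sub>0) *v X 0"
    using rotated_coords_bessel_sol[of 0 1 \<theta>\<^sub>0] X(1) by (auto simp: rotated_coords_iff dest: spec[of _ 0])
  moreover have "Z 0 = rotation_matrix (- \<theta> 0) *v X 0"
    using X(2) by (auto simp: rotated_coords_iff)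
  ultimately have "bessel_state C\<^sub>1 0 \<theta>\<^sub>0 = bessel_state 0 1 \<theta>\<^sub>0" by simp
  then show False
    using bessel_state_inj(2)[OF assms] by fastforce
qed

section \<open>Stability of the two coordinates\<close>

lemma coord_asymptotically_stable_1:
  assumes "\<rho> < 0"
  shows "coord_asymptotically_stable \<rho> 1"
  unfolding coord_asymptotically_stable_def
proof
  show "coord_stable \<rho> 1"
    unfolding coord_stable_def
  proof (intro allI impI)
    fix \<epsilon> :: real
    assume "\<epsilon> > 0"
    \<comment> \<open>Since the norm of X never grows, \<delta> = \<epsilon> is good enough.\<close>
    moreover have "\<bar>X t $ 1\<bar> < \<epsilon>"
      if "closed_loop \<rho> X \<theta>" "norm (X 0, \<theta> 0) < \<epsilon>" "t \<ge> 0" for X \<theta> t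
    proof -
      have "\<bar>X t $ 1\<bar> \<le> norm (X t)" by (rule component_le_norm_cart)
      also have "\<dots> \<le> norm (X 0)"
        using closed_loop_norm_le[OF that(1) _ that(3)] assms by simp
      also have "\<dots> \<le> norm (X 0, \<theta> 0)" using norm_fst_le[of "X 0" "\<theta> 0"] by simp
      finally show ?thesis using that(2) by simp
    qed
    ultimately show "\<exists>\<delta>>0. \<forall>X \<theta>. closed_loop \<rho> X \<theta> \<and> norm (X 0, \<theta> 0) < \<delta> \<longrightarrow> (\<forall>t\<ge>0. \<bar>X t $ 1\<bar> < \<epsilon>)"
      by blast
  qed
  have "((\<lambda>t. X t $ 1) \<longlongrightarrow> 0) at_top" if cl: "closed_loop \<rho> X \<theta>" for X \<theta>
  proof -
    have "- \<rho> > 0" using assms by simp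
    obtain y where "((\<lambda>t. X (t / - \<rho>)) \<longlongrightarrow> vector [0, y]) at_top"
      using closed_loop_tendsto cl[unfolded closed_loop_normalize[OF assms]] by blast
    then have "(X \<longlongrightarrow> vector [0, y]) at_top"
      unfolding tendsto_at_top_rescale_iff[OF \<open>- \<rho> > 0\<close>] .
    from tendsto_vec_nth[OF this, of 1] show ?thesis by simp
  qed
  \<comment> \<open>Convergence of x_c is global, so any radius serves, here 1.\<close>
  then show "coord_attractive \<rho> 1"
    unfolding coord_attractive_def using zero_less_one by blast
qed

text \<open>What fails is attractivity: for negative \<rho> the norm bound keeps y_c small as well,
  but equilibria on the y_c axis accumulate at the origin.\<close>

lemma not_coord_asymptotically_stable_2: "\<not> coord_asymptotically_stable \<rho> 2"
proof
  assume "coord_asymptotically_stable \<rho> 2"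
  then obtain \<delta> where "\<delta> > 0" and attr: "\<And>X \<theta>. closed_loop \<rho> X \<theta> \<Longrightarrow> norm (X 0, \<theta> 0) < \<delta> \<Longrightarrow>
      ((\<lambda>t. X t $ 2) \<longlongrightarrow> 0) at_top"
    unfolding coord_asymptotically_stable_def coord_attractive_def by blast
  \<comment> \<open>An equilibrium strictly inside the supposed region of attraction, with nonzero
    second coordinate.\<close>
  let ?L = "vector [0, \<delta> / 2] :: real^2"
  have "closed_loop \<rho> (\<lambda>t. ?L) (\<lambda>t. 0)"
    unfolding closed_loop_iff by simp
  moreover have "norm (?L, 0 :: real) < \<delta>"
    using \<open>\<delta> > 0\<close> by (simp add: norm_Pair norm_vec_def L2_set_def sum_2)
  ultimately have "((\<lambda>t::real. \<delta> / 2) \<longlongrightarrow> 0) at_top"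
    using attr[of "\<lambda>t. ?L" "\<lambda>t. 0"] by simp
  then show False
    using \<open>\<delta> > 0\<close> by (simp add: tendsto_const_iff)
qed

theorem mainTheorem3:
  fixes \<rho> :: real
  assumes "\<rho> < 0"
  shows
    "(\<forall>X \<theta>. closed_loop \<rho> X \<theta> \<longleftrightarrow>
        closed_loop (-1) (\<lambda>t. X (t / (- \<rho>))) (\<lambda>t. \<theta> (t / (- \<rho>)))) \<and>
     (\<forall>X\<^sub>0 \<theta>\<^sub>0. \<exists>X \<theta>. closed_loop (-1) X \<theta> \<and> X 0 = X\<^sub>0 \<and> \<theta> 0 = \<theta>\<^sub>0) \<and>
     (\<forall>X\<^sub>0 \<theta>\<^sub>0. \<theta>\<^sub>0 \<noteq> 0 \<longrightarrow>
        (\<exists>!C. \<forall>X \<theta> Z.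
           closed_loop (-1) X \<theta> \<and> X 0 = X\<^sub>0 \<and> \<theta> 0 = \<theta>\<^sub>0 \<and> rotated_coords X \<theta> Z \<longrightarrow>
           bessel_form \<theta>\<^sub>0 (fst C) (snd C) \<theta> Z)) \<and>
     (\<forall>X \<theta> Z \<theta>\<^sub>0 C\<^sub>1 C\<^sub>2.
        closed_loop (-1) X \<theta> \<and> \<theta>\<^sub>0 \<noteq> 0 \<and> rotated_coords X \<theta> Z \<and> bessel_form \<theta>\<^sub>0 C\<^sub>1 C\<^sub>2 \<theta> Z \<longrightarrow>
        ((\<lambda>t. Z t $ 1) \<longlongrightarrow> 0) at_top \<and>
        ((\<lambda>t. Z t $ 2) \<longlongrightarrow> 2 * C\<^sub>2 / pi) at_top \<and>
        (X \<longlongrightarrow> vector [0, 2 * C\<^sub>2 / pi]) at_top) \<and>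
     (\<forall>\<theta>\<^sub>0. attractors_from \<rho> \<theta>\<^sub>0 = {L. L $ 1 = 0}) \<and>
     (\<forall>\<theta>\<^sub>0. \<theta>\<^sub>0 \<noteq> 0 \<longrightarrow>
        {X 0 |X \<theta> Z C\<^sub>1. closed_loop (-1) X \<theta> \<and> rotated_coords X \<theta> Z \<and> bessel_form \<theta>\<^sub>0 C\<^sub>1 0 \<theta> Z}
        \<noteq> UNIV) \<and>
     coord_asymptotically_stable \<rho> 1 \<and>
     \<not> coord_asymptotically_stable \<rho> 2"
proof (intro conjI)
  show "\<forall>X \<theta>. closed_loop \<rho> X \<theta> \<longleftrightarrow>
        closed_loop (-1) (\<lambda>t. X (t / (- \<rho>))) (\<lambda>t. \<theta> (t / (- \<rho>)))"
    by (intro allI closed_loop_normalize[OF assms])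
  show "\<forall>X\<^sub>0 \<theta>\<^sub>0. \<exists>X \<theta>. closed_loop (-1) X \<theta> \<and> X 0 = X\<^sub>0 \<and> \<theta> 0 = \<theta>\<^sub>0"
    by (intro allI closed_loop_exists)
  show "\<forall>X\<^sub>0 \<theta>\<^sub>0. \<theta>\<^sub>0 \<noteq> 0 \<longrightarrow>
        (\<exists>!C. \<forall>X \<theta> Z.
           closed_loop (-1) X \<theta> \<and> X 0 = X\<^sub>0 \<and> \<theta> 0 = \<theta>\<^sub>0 \<and> rotated_coords X \<theta> Z \<longrightarrow>
           bessel_form \<theta>\<^sub>0 (fst C) (snd C) \<theta> Z)"
    by (intro allI impI ex1_bessel_constants)
  show "\<forall>X \<theta> Z \<theta>\<^sub>0 C\<^sub>1 C\<^sub>2.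
        closed_loop (-1) X \<theta> \<and> \<theta>\<^sub>0 \<noteq> 0 \<and> rotated_coords X \<theta> Z \<and> bessel_form \<theta>\<^sub>0 C\<^sub>1 C\<^sub>2 \<theta> Z \<longrightarrow>
        ((\<lambda>t. Z t $ 1) \<longlongrightarrow> 0) at_top \<and>
        ((\<lambda>t. Z t $ 2) \<longlongrightarrow> 2 * C\<^sub>2 / pi) at_top \<and>
        (X \<longlongrightarrow> vector [0, 2 * C\<^sub>2 / pi]) at_top"
    using bessel_form_tendsto by blast
  show "\<forall>\<theta>\<^sub>0. attractors_from \<rho> \<theta>\<^sub>0 = {L. L $ 1 = 0}"
    by (intro allI attractors_from_eq[OF assms])
  show "\<forall>\<theta>\<^sub>0. \<theta>\<^sub>0 \<noteq> 0 \<longrightarrow>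
        {X 0 |X \<theta> Z C\<^sub>1. closed_loop (-1) X \<theta> \<and> rotated_coords X \<theta> Z \<and> bessel_form \<theta>\<^sub>0 C\<^sub>1 0 \<theta> Z}
        \<noteq> UNIV"
    by (intro allI impI zero_C2_initial_positions_neq_UNIV)
  show "coord_asymptotically_stable \<rho> 1"
    by (rule coord_asymptotically_stable_1[OF assms])
  show "\<not> coord_asymptotically_stable \<rho> 2"
    by (rule not_coord_asymptotically_stable_2)
qed

end
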